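(* There is an absolute constant $c>0$ such that for every prime $n$ the domination number of the discrete torus $T_n$ satisfies $D_n^T \ge c\sqrt n$; that is, $D_n^T=\Omega(\sqrt n)$ for $n$ prime.
   Context: The discrete $n\times n$ torus is $T_n=\{0,1,\dots,n-1\}\times\{0,1,\dots,n-1\}$, and $\pi_n:\mathbb Z\times\mathbb Z\to T_n$ is $\pi_n(x_1,x_2)=(x_1 \bmod n,\ x_2\bmod n)$, where $a \bmod b$ is the smallest non-negative remainder. A line in $\mathbb Z\times\mathbb Z$ is the intersection with $\mathbb Z\times\mathbb Z$ of a straight line in the plane through at least two integer points. A line on the torus $T_n$ is the image under $\pi_n$ of a line in $\mathbb Z\times\mathbb Z$. A set of points of $T_n$ is collinear if it is contained in a line on the torus. A point $p\in T_n$ is dominated by $S\subseteq T_n$ if $p\in S$ or there exist two distinct points $x,y\in S$ such that $\{x,y,p\}$ is collinear on the torus. $S$ is a dominating set of $T_n$ if every point of $T_n$ is dominated by $S$. The domination number $D_n^T$ is the smallest size of a dominating set of $T_n$. *)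

theory Defs
  imports "HOL-Analysis.Analysis" "HOL-Computational_Algebra.Primes"
begin

definition torus :: "nat \<Rightarrow> (int \<times> int) set" where
  "torus n = {0..<int n} \<times> {0..<int n}"

(* For n > 0, mod on int is the smallest non-negative remainder. *)
definition torus_proj :: "nat \<Rightarrow> int \<times> int \<Rightarrow> int \<times> int" where
  "torus_proj n = (\<lambda>(x, y). (x mod int n, y mod int n))"

definition int_point :: "int \<times> int \<Rightarrow> real \<times> real" where
  "int_point = (\<lambda>(x, y). (real_of_int x, real_of_int y))"

(* A straight line in the plane is a one-dimensional affine subspace of real \<times> real. *)
definition lattice_line :: "(int \<times> int) set \<Rightarrow> bool" where
  "lattice_line A \<longleftrightarrow>
     (\<exists>L :: (real \<times> real) set. affine L \<and> aff_dim L = 1 \<and>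
        (\<exists>p q. p \<noteq> q \<and> int_point p \<in> L \<and> int_point q \<in> L) \<and>
        A = int_point -` L)"

definition torus_line :: "nat \<Rightarrow> (int \<times> int) set \<Rightarrow> bool" where
  "torus_line n M \<longleftrightarrow> (\<exists>A. lattice_line A \<and> M = torus_proj n ` A)"

definition torus_collinear :: "nat \<Rightarrow> (int \<times> int) set \<Rightarrow> bool" where
  "torus_collinear n P \<longleftrightarrow> (\<exists>M. torus_line n M \<and> P \<subseteq> M)"

definition dominated :: "nat \<Rightarrow> (int \<times> int) set \<Rightarrow> int \<times> int \<Rightarrow> bool" where
  "dominated n S p \<longleftrightarrow>
     p \<in> S \<or> (\<exists>x\<in>S. \<exists>y\<in>S. x \<noteq> y \<and> torus_collinear n {x, y, p})"

definition dominating_set :: "nat \<Rightarrow> (int \<times> int) set \<Rightarrow> bool" where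
  "dominating_set n S \<longleftrightarrow> S \<subseteq> torus n \<and> (\<forall>p\<in>torus n. dominated n S p)"

(* The minimum is attained: torus n is finite and dominates itself. *)
definition domination_number :: "nat \<Rightarrow> nat" where
  "domination_number n = (LEAST k. \<exists>S. dominating_set n S \<and> card S = k)"

end

theory Submission
  imports Defs
begin

text \<open>
  Three points on a torus line lift to collinear lattice points, whose determinant vanishes over the
  integers and hence modulo n. For n prime and two distinct points fixed, the determinant vanishes
  modulo n at no more than n third points of the torus. A dominating set of size k therefore
  dominates at most k + k (k - 1) n points out of n * n, which forces k * k to be at least n.
\<close>

text \<open>The 2x2 determinant of the vectors \<open>p - x\<close> and \<open>y - x\<close>. Being
  an integer polynomial in the coordinates, it can be reduced modulo \<open>n\<close>.\<close>

definition cross_det :: "int \<times> int \<Rightarrow> int \<times> int \<Rightarrow> int \<times> int \<Rightarrow> int" where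
  "cross_det x y p = (fst p - fst x) * (snd y - snd x) - (snd p - snd x) * (fst y - fst x)"

text \<open>Differences of points of a line are multiples of one direction \<open>u\<close>, so the
  two vectors in the determinant are parallel.\<close>

lemma cross_det_lattice_line:
  assumes "lattice_line A" "x \<in> A" "y \<in> A" "p \<in> A"
  shows "cross_det x y p = 0"
proof -
  obtain L :: "(real \<times> real) set" where L: "aff_dim L = 1" "A = int_point -` L"
    using assms(1) unfolding lattice_line_def by blast
  have "collinear L" using L(1) by (simp add: collinear_aff_dim)
  then obtain u where u: "\<And>a b. a \<in> L \<Longrightarrow> b \<in> L \<Longrightarrow> \<exists>c. a - b = c *\<^sub>R u"
    unfolding collinear_def by blast
  obtain c where c: "int_point p - int_point x = c *\<^sub>R u"
    using u assms L(2) by blast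
  obtain d where d: "int_point y - int_point x = d *\<^sub>R u"
    using u assms L(2) by blast
  have "real_of_int (fst p - fst x) = c * fst u" "real_of_int (snd p - snd x) = c * snd u"
    using arg_cong[OF c, of fst] arg_cong[OF c, of snd]
    by (simp_all add: int_point_def case_prod_beta)
  moreover have "real_of_int (fst y - fst x) = d * fst u" "real_of_int (snd y - snd x) = d * snd u"
    using arg_cong[OF d, of fst] arg_cong[OF d, of snd]
    by (simp_all add: int_point_def case_prod_beta)
  ultimately have "real_of_int (cross_det x y p) = 0"
    \<comment> \<open>Instantiating with a product splits only the outer difference. The coordinate
      differences stay intact and are rewritten to multiples of \<open>u\<close>, whose products
      cancel.\<close>
    unfolding cross_det_def of_int_diff[of "_ * _"] of_int_mult by simp
  then show ?thesis by simp
qed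

lemma cross_det_torus_proj:
  "cross_det (torus_proj n x) (torus_proj n y) (torus_proj n p) mod int n = cross_det x y p mod int n"
  unfolding cross_det_def torus_proj_def case_prod_beta fst_conv snd_conv
  by (intro mod_diff_cong[OF mod_mult_cong mod_mult_cong] mod_diff_eq)

text \<open>The lifts of the three points to a common lattice line have determinant 0, and
  projecting them preserves the determinant modulo \<open>n\<close>.\<close>

lemma torus_collinear_imp_dvd_cross_det:
  assumes "torus_collinear n {x, y, p}"
  shows "int n dvd cross_det x y p"
proof -
  obtain A where A: "lattice_line A" "{x, y, p} \<subseteq> torus_proj n ` A"
    using assms unfolding torus_collinear_def torus_line_def by blast
  then have "x \<in> torus_proj n ` A" "y \<in> torus_proj n ` A" "p \<in> torus_proj n ` A"
    by simp_all
  then obtain x' y' p' where "x' \<in> A" "y' \<in> A" "p' \<in> A"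
    and eq: "x = torus_proj n x'" "y = torus_proj n y'" "p = torus_proj n p'"
    by (elim imageE)
  then have "cross_det x' y' p' = 0" using cross_det_lattice_line A(1) by blast
  then have "cross_det x y p mod int n = 0"
    using cross_det_torus_proj[of n x' y' p'] unfolding eq by simp
  then show ?thesis by (rule mod_0_imp_dvd)
qed

lemma eq_if_dvd_diff_less:
  fixes a b m :: int
  assumes "a \<in> {0..<m}" "b \<in> {0..<m}" "m dvd a - b"
  shows "a = b"
proof -
  have "a mod m = b mod m" using assms(3) by (simp add: mod_eq_dvd_iff)
  then show ?thesis using assms(1,2) by simp
qed

text \<open>Primality lets the factor \<open>c\<close> be cancelled; the range then makes congruent
  numbers equal.\<close>

lemma eq_if_dvd_mult_diff_less:
  fixes a b c m :: int
  assumes "prime m" "\<not> m dvd c" "m dvd (a - b) * c" "a \<in> {0..<m}" "b \<in> {0..<m}"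
  shows "a = b"
proof -
  have "m dvd a - b" using assms(1-3) by (simp add: prime_dvd_mult_iff)
  then show ?thesis using assms(4,5) by (rule eq_if_dvd_diff_less[rotated 2])
qed

text \<open>Over the field of residues modulo \<open>n\<close> this is a nontrivial linear equation
  in \<open>p\<close>, so one coordinate of a solution determines the other.\<close>

lemma card_cross_det_solutions:
  assumes "prime n" "x \<in> torus n" "y \<in> torus n" "x \<noteq> y"
  shows "card {p \<in> torus n. int n dvd cross_det x y p} \<le> n" (is "card ?L \<le> n")
proof -
  have pr: "prime (int n)" using assms(1) by simp
  \<comment> \<open>The difference of two solutions solves the homogeneous equation.\<close>
  have diff: "int n dvd (fst p - fst q) * (snd y - snd x) - (snd p - snd q) * (fst y - fst x)"
    if "p \<in> ?L" "q \<in> ?L" for p q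
  proof -
    have "int n dvd cross_det x y p - cross_det x y q" using that by (auto intro: dvd_diff)
    then show ?thesis by (simp add: cross_det_def algebra_simps)
  qed
  have bounds: "fst p \<in> {0..<int n}" "snd p \<in> {0..<int n}" if "p \<in> torus n" for p
    using that unfolding torus_def by auto
  have bound: "card ?L \<le> n" if "inj_on f ?L" "f ` ?L \<subseteq> {0..<int n}" for f
    using card_inj_on_le[OF that] by simp
  show ?thesis
  \<comment> \<open>The split selects an invertible coefficient: \<open>fst y - fst x\<close> makes
    \<open>fst\<close> injective on the solutions, and otherwise \<open>snd y - snd x\<close> makes
    \<open>snd\<close> injective.\<close>
  proof (cases "int n dvd fst y - fst x")
    case False
    have "inj_on fst ?L"
    proof (rule inj_onI)
      fix p q assume pq: "p \<in> ?L" "q \<in> ?L" "fst p = fst q"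
      then have "int n dvd (snd p - snd q) * (fst y - fst x)"
        using diff[of p q] by simp
      then have "snd p = snd q"
        using eq_if_dvd_mult_diff_less[OF pr False] bounds(2) pq(1,2) by blast
      then show "p = q" using pq(3) by (simp add: prod_eq_iff)
    qed
    then show ?thesis by (rule bound) (auto simp: torus_def)
  next
    case True
    then have x1: "fst y = fst x"
      by (rule eq_if_dvd_diff_less[OF bounds(1)[OF assms(3)] bounds(1)[OF assms(2)]])
    then have False': "\<not> int n dvd snd y - snd x"
      using eq_if_dvd_diff_less[OF bounds(2)[OF assms(3)] bounds(2)[OF assms(2)]] assms(4)
      by (metis prod_eqI)
    have "inj_on snd ?L"
    proof (rule inj_onI)
      fix p q assume pq: "p \<in> ?L" "q \<in> ?L" "snd p = snd q"
      then have "int n dvd (fst p - fst q) * (snd y - snd x)"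
        using diff[of p q] by simp
      then have "fst p = fst q"
        using eq_if_dvd_mult_diff_less[OF pr False'] bounds(1) pq(1,2) by blast
      then show "p = q" using pq(3) by (simp add: prod_eq_iff)
    qed
    then show ?thesis by (rule bound) (auto simp: torus_def)
  qed
qed

lemma finite_torus: "finite (torus n)"
  by (simp add: torus_def)

lemma card_torus: "card (torus n) = n\<^sup>2"
  by (simp add: torus_def card_cartesian_product power2_eq_square)

lemma card_dominating_set_squared:
  assumes "prime n" "dominating_set n S"
  shows "n \<le> (card S)\<^sup>2"
proof -
  have S: "S \<subseteq> torus n" "\<And>p. p \<in> torus n \<Longrightarrow> dominated n S p"
    using assms(2) unfolding dominating_set_def by auto
  have fin: "finite S" using S(1) finite_torus finite_subset by blast
  define k where "k = card S"
  \<comment> \<open>Ordered pairs of distinct points: each unordered pair is counted twice, which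
    costs only a constant factor.\<close>
  define D where "D = S \<times> S - (\<lambda>x. (x, x)) ` S"
  define sol where "sol = (\<lambda>(x, y). {p \<in> torus n. int n dvd cross_det x y p})"
  have finD: "finite D" using fin by (simp add: D_def)
  have "card ((\<lambda>x. (x, x)) ` S) = k"
    by (simp add: k_def card_image inj_on_def)
  moreover have "(\<lambda>x. (x, x)) ` S \<subseteq> S \<times> S" by blast
  ultimately have cardD: "card D = k * k - k"
    using fin by (simp add: D_def k_def card_Diff_subset card_cartesian_product)
  have "torus n \<subseteq> S \<union> (\<Union>d\<in>D. sol d)"
  proof
    fix p assume p: "p \<in> torus n"
    show "p \<in> S \<union> (\<Union>d\<in>D. sol d)"
    proof (cases "p \<in> S")
      case False
      then obtain x y where "x \<in> S" "y \<in> S" "x \<noteq> y" "torus_collinear n {x, y, p}"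
        using S(2)[OF p] unfolding dominated_def by blast
      then have "(x, y) \<in> D" "p \<in> sol (x, y)"
        using p torus_collinear_imp_dvd_cross_det by (auto simp: D_def sol_def)
      then show ?thesis by blast
    qed simp
  qed
  moreover have "finite (S \<union> (\<Union>d\<in>D. sol d))"
    using fin finD finite_torus by (auto simp: sol_def)
  ultimately have "n\<^sup>2 \<le> card (S \<union> (\<Union>d\<in>D. sol d))"
    using card_mono card_torus by metis
  also have "\<dots> \<le> k + (\<Sum>d\<in>D. card (sol d))"
    unfolding k_def using card_UN_le[OF finD, of sol] card_Un_le[of S "\<Union>d\<in>D. sol d"] by linarith
  also have "(\<Sum>d\<in>D. card (sol d)) \<le> card D * n"
  proof (rule sum_bounded_above[where K = n, simplified])
    fix d assume d: "d \<in> D"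
    obtain x y where "d = (x, y)" by (cases d)
    with d S(1) have "x \<in> torus n" "y \<in> torus n" "x \<noteq> y"
      unfolding D_def by blast+
    then show "card (sol d) \<le> n"
      using card_cross_det_solutions[OF assms(1)] \<open>d = (x, y)\<close> by (simp add: sol_def)
  qed
  also have "k + card D * n \<le> k\<^sup>2 * n"
  proof -
    \<comment> \<open>The \<open>k\<close> points of \<open>S\<close> are charged to the
      \<open>k\<close> diagonal pairs left out of \<open>D\<close>, at \<open>n\<close> each, which
      rounds the bound up to \<open>k\<^sup>2 * n\<close>.\<close>
    have "k \<le> k * n" using prime_gt_0_nat[OF assms(1)] by simp
    then have "k + card D * n \<le> (k + card D) * n" by (simp add: algebra_simps)
    \<comment> \<open>The natural-number subtraction in \<open>cardD\<close> does not truncate,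
      since \<open>k\<close> \<le> \<open>k * k\<close>.\<close>
    also have "k + card D = k\<^sup>2"
      using cardD by (simp add: power2_eq_square)
    finally show ?thesis .
  qed
  finally have "n * n \<le> k\<^sup>2 * n" by (simp only: power2_eq_square[of n])
  then show ?thesis
    using prime_gt_0_nat[OF assms(1)] unfolding mult_le_cancel2 k_def by blast
qed

lemma dominating_set_torus: "dominating_set n (torus n)"
  by (simp add: dominating_set_def dominated_def)

text \<open>Carries a bound valid for every dominating set over to the minimum; the whole torus
  shows that the set of sizes is nonempty.\<close>

lemma domination_number_attained:
  "\<exists>S. dominating_set n S \<and> card S = domination_number n"
  unfolding domination_number_def
  by (rule LeastI_ex) (use dominating_set_torus in blast)

theorem theorem5:
  "\<exists>c::real. c > 0 \<and> (\<forall>n::nat. prime n \<longrightarrow> real (domination_number n) \<ge> c * sqrt (real n))"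
\<comment> \<open>The counting bound has no loss factor, so \<open>c = 1\<close> works after taking
  square roots.\<close>
proof (intro exI[of _ 1] conjI allI impI)
  fix n :: nat
  assume "prime n"
  then have "n \<le> (domination_number n)\<^sup>2"
    using card_dominating_set_squared domination_number_attained by metis
  then have "real n \<le> (real (domination_number n))\<^sup>2"
    by (metis of_nat_le_iff of_nat_power)
  then show "real (domination_number n) \<ge> 1 * sqrt (real n)"
    by (simp add: real_le_lsqrt)
qed simp

end
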